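(* Let $F$ be a number field with ring of integers $\mathcal{O}_F$ and class number $h_F$. Suppose there is a prime $p \ge 5$ totally ramified in $F$ satisfying: (i) $\gcd\left([F:\mathbb{Q}], \frac{p-1}{2}\right) = 1$; and (ii) $\gcd(2h_F, p-1) = 2$. Then the unit equation $\lambda + \mu = 1$ has no solutions with $\lambda, \mu \in \mathcal{O}_F^\times$.
   Context: A rational prime $p$ is totally ramified in a number field $F$ if $p\mathcal{O}_F = \mathfrak{p}^{[F:\mathbb{Q}]}$ for a prime ideal $\mathfrak{p}$ of $\mathcal{O}_F$. $\mathcal{O}_F^\times$ denotes the unit group of $\mathcal{O}_F$. *)

theory Defs
  imports
    "HOL-Algebra.Algebra"
    "HOL-Algebra.Algebraic_Closure_Type"
    "HOL-Computational_Algebra.Computational_Algebra"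
begin

definition rat_scale :: "rat \<Rightarrow> 'a::field_char_0 \<Rightarrow> 'a"
  where "rat_scale q x = of_rat q * x"

global_interpretation rat_vs: vector_space "rat_scale :: rat \<Rightarrow> 'a::field_char_0 \<Rightarrow> 'a"
  by unfold_locales (simp_all add: rat_scale_def algebra_simps of_rat_add of_rat_mult)

(* The field is the whole type 'a. The dimension in field_degree would be 0 for an
   extension of infinite degree, which number_field excludes. *)
definition number_field :: "'a::field_char_0 itself \<Rightarrow> bool"
  where "number_field _ \<longleftrightarrow> (\<exists>B :: 'a set. finite B \<and> rat_vs.span B = UNIV)"

definition field_degree :: "'a::field_char_0 itself \<Rightarrow> nat"
  where "field_degree _ = rat_vs.dim (UNIV :: 'a set)"

definition ring_of_integers :: "'a::field_char_0 itself \<Rightarrow> 'a ring"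
  where "ring_of_integers _ = ring_of_type_algebra \<lparr>carrier := {x :: 'a. algebraic_int x}\<rparr>"

definition totally_ramified :: "'a::field_char_0 itself \<Rightarrow> nat \<Rightarrow> bool"
  where "totally_ramified F p \<longleftrightarrow>
    (\<exists>P. primeideal P (ring_of_integers F) \<and>
         PIdl\<^bsub>ring_of_integers F\<^esub> (of_nat p) =
           P [^]\<^bsub>ideals_set (ring_of_integers F)\<^esub> field_degree F)"

definition fractional_ideal :: "'a::field_char_0 set \<Rightarrow> bool"
  where "fractional_ideal I \<longleftrightarrow>
    (\<exists>d J. d \<in> carrier (ring_of_integers TYPE('a)) \<and> d \<noteq> 0 \<and>
           ideal J (ring_of_integers TYPE('a)) \<and> J \<noteq> {0} \<and> I = (\<lambda>x. x / d) ` J)"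

(* ideal_prod over the whole field is the additive closure of the set of products,
   hence the product of fractional ideals as submodules of the field. *)
definition fractional_ideal_group :: "'a::field_char_0 itself \<Rightarrow> 'a set monoid"
  where "fractional_ideal_group F =
    \<lparr>carrier = {I. fractional_ideal I},
     monoid.mult = ideal_prod ring_of_type_algebra,
     one = carrier (ring_of_integers F)\<rparr>"

definition principal_fractional_ideals :: "'a::field_char_0 itself \<Rightarrow> 'a set set"
  where "principal_fractional_ideals F =
    {(\<lambda>x. a * x) ` carrier (ring_of_integers F) |a. a \<noteq> 0}"

definition class_group :: "'a::field_char_0 itself \<Rightarrow> 'a set set monoid"
  where "class_group F = fractional_ideal_group F Mod principal_fractional_ideals F"

definition class_number :: "'a::field_char_0 itself \<Rightarrow> nat"
  where "class_number F = Coset.order (class_group F)"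

end

theory Submission
  imports Defs "HOL-Number_Theory.Residues"
begin

text \<open>Let \<open>n = [F : \<rat>]\<close> and \<open>p \<O> = P\<^sup>n\<close>. The residue field of \<open>P\<close> is \<open>\<bbbF>\<^sub>p\<close>, so a unit \<open>u\<close> is congruent
  to an integer \<open>a\<close> modulo \<open>P\<close>. Then \<open>(u - a)\<^sup>n \<in> p \<O>\<close>, which forces the minimal polynomial of
  \<open>u - a\<close>, of degree \<open>d\<close> say, to be \<open>X\<^sup>d\<close> modulo \<open>p\<close>. Its value at \<open>-a\<close> is the norm of \<open>u\<close> from
  \<open>\<rat>(u)\<close> up to sign, hence \<open>\<plusminus>1\<close>, so that \<open>a\<^sup>2\<^sup>d \<equiv> 1\<close> modulo \<open>p\<close>. As \<open>d\<close> divides \<open>n\<close>, it is coprime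
  to \<open>(p - 1) / 2\<close>, and \<open>a \<equiv> \<plusminus>1\<close>. So \<open>u + v = 1\<close> for units \<open>u, v\<close> would give \<open>\<plusminus>1 \<plusminus> 1 \<equiv> 1\<close>
  modulo \<open>p\<close>, which is impossible for \<open>p \<ge> 5\<close>.\<close>

subsection \<open>Linear algebra over the rational numbers\<close>

lemma common_denominator:
  fixes q :: "'i \<Rightarrow> rat"
  assumes "finite I"
  shows "\<exists>D z. D > 0 \<and> (\<forall>i\<in>I. q i * of_int D = of_int (z i))"
  using assms
proof induction
  case empty
  then show ?case by (intro exI[of _ 1]) simp
next
  case (insert j I)
  then obtain D z where D: "D > 0" "\<forall>i\<in>I. q i * of_int D = of_int (z i)"
    by blast
  obtain a b where ab: "q j = of_int a / of_int b" "b > 0"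
    by (metis quotient_of_div quotient_of_denom_pos surj_pair)
  have "\<forall>i\<in>insert j I. q i * of_int (D * b) = of_int ((if i = j then a * D else z i * b))"
  proof
    fix i assume i: "i \<in> insert j I"
    show "q i * of_int (D * b) = of_int ((if i = j then a * D else z i * b))"
    proof (cases "i = j")
      case False
      then have "q i * of_int D = of_int (z i)" using D i by auto
      then show ?thesis using False by (simp flip: mult.assoc)
    qed (use ab in \<open>simp add: field_simps\<close>)
  qed
  moreover have "D * b > 0" using D ab by simp
  ultimately show ?case
    by (intro exI[of _ "D * b"] exI[of _ "\<lambda>i. if i = j then a * D else z i * b"]) blast
qed

text \<open>A rational relation becomes integral after clearing denominators. The family is indexed,
  so a repeated value counts as dependent through \<open>x i - x j = 0\<close>.\<close>

lemma integer_relation: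
  fixes x :: "'i \<Rightarrow> 'a::field_char_0"
  assumes I: "finite I" and dep: "\<not> inj_on x I \<or> rat_vs.dependent (x ` I)"
  shows "\<exists>c::'i \<Rightarrow> int. (\<Sum>i\<in>I. of_int (c i) * x i) = 0 \<and> (\<exists>i\<in>I. c i \<noteq> 0)"
proof (cases "inj_on x I")
  case False
  then obtain i j where ij: "i \<in> I" "j \<in> I" "i \<noteq> j" "x i = x j"
    unfolding inj_on_def by blast
  define c :: "'i \<Rightarrow> int" where "c = (\<lambda>k. of_bool (k = i) - of_bool (k = j))"
  have "(\<Sum>k\<in>I. of_int (c k) * x k) = (\<Sum>k\<in>I. (if k = i then x k else 0) - (if k = j then x k else 0))"
    by (rule sum.cong) (auto simp: c_def)
  also have "\<dots> = 0" using I ij by (simp add: sum_subtractf)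
  finally show ?thesis using ij by (intro exI[of _ c]) (auto simp: c_def)
next
  case True
  with dep have "rat_vs.dependent (x ` I)" by simp
  then obtain u where u: "\<exists>v\<in>x ` I. u v \<noteq> 0" "(\<Sum>v\<in>x ` I. rat_scale (u v) v) = 0"
    using rat_vs.dependent_finite[of "x ` I"] I by auto
  obtain D z where D: "D > 0" "\<forall>i\<in>I. u (x i) * of_int D = of_int (z i)"
    using common_denominator[OF I, of "\<lambda>i. u (x i)"] by blast
  have z: "of_int (z i) = (of_int D * of_rat (u (x i)) :: 'a)" if "i \<in> I" for i
    using D(2) that by (metis mult.commute of_rat_mult of_rat_of_int_eq)
  have "(\<Sum>i\<in>I. of_int (z i) * x i) = of_int D * (\<Sum>i\<in>I. rat_scale (u (x i)) (x i))"
    unfolding sum_distrib_left rat_scale_def by (rule sum.cong) (auto simp: z)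
  also have "\<dots> = 0" using u(2) by (simp add: sum.reindex[OF True])
  finally have "(\<Sum>i\<in>I. of_int (z i) * x i) = 0" .
  moreover from u(1) obtain i where i: "i \<in> I" "u (x i) \<noteq> 0" by blast
  moreover have "z i \<noteq> 0" using i D by (metis mult_eq_0_iff of_int_0_eq_iff less_irrefl)
  ultimately show ?thesis by blast
qed

text \<open>As long as \<open>p\<close> divides all coefficients it can be cancelled, and the sum of
  their absolute values drops.\<close>

lemma primitive_integer_relation:
  fixes x :: "'i \<Rightarrow> 'a::field_char_0" and p :: nat
  assumes I: "finite I" and dep: "\<not> inj_on x I \<or> rat_vs.dependent (x ` I)"
    and p: "p > 1"
  shows "\<exists>c::'i \<Rightarrow> int. (\<Sum>i\<in>I. of_int (c i) * x i) = 0 \<and> (\<exists>i\<in>I. \<not> int p dvd c i)"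
proof -
  have "\<exists>c'::'i \<Rightarrow> int. (\<Sum>i\<in>I. of_int (c' i) * x i) = 0 \<and> (\<exists>i\<in>I. \<not> int p dvd c' i)"
    if "(\<Sum>i\<in>I. of_int (c i) * x i) = 0" "\<exists>i\<in>I. c i \<noteq> 0" for c
    using that
  proof (induction "\<Sum>i\<in>I. nat \<bar>c i\<bar>" arbitrary: c rule: less_induct)
    case less
    show ?case
    proof (cases "\<exists>i\<in>I. \<not> int p dvd c i")
      case True
      then show ?thesis using less.prems by blast
    next
      case False
      then have c: "c i = int p * (c i div int p)" if "i \<in> I" for i using that by simp
      define e where "e = (\<lambda>i. c i div int p)"
      have ce: "c i = int p * e i" if "i \<in> I" for i using c that by (simp add: e_def)
      have "(\<Sum>i\<in>I. of_int (c i) * x i) = of_nat p * (\<Sum>i\<in>I. of_int (e i) * x i)"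
        unfolding sum_distrib_left by (rule sum.cong) (auto simp: ce)
      then have e0: "(\<Sum>i\<in>I. of_int (e i) * x i) = 0" using less.prems p by simp
      obtain i where i: "i \<in> I" "c i \<noteq> 0" using less.prems by blast
      have e1: "\<exists>i\<in>I. e i \<noteq> 0" using i ce by force
      have le: "nat \<bar>e j\<bar> \<le> nat \<bar>c j\<bar>" if "j \<in> I" for j
        using ce[OF that] p by (simp add: abs_mult nat_mult_distrib)
      have "e i \<noteq> 0" using i ce by force
      then have "nat \<bar>e i\<bar> < nat \<bar>c i\<bar>"
        using ce[OF i(1)] p by (simp add: abs_mult nat_mult_distrib)
      then have "(\<Sum>i\<in>I. nat \<bar>e i\<bar>) < (\<Sum>i\<in>I. nat \<bar>c i\<bar>)"
        using i le I by (intro sum_strict_mono_ex1) auto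
      from less.hyps[OF this e0 e1] show ?thesis .
    qed
  qed
  with integer_relation[OF I dep] show ?thesis by blast
qed

lemma number_field_basis:
  assumes "number_field TYPE('a)"
  obtains B :: "'a::field_char_0 set" where "finite_dimensional_vector_space rat_scale B"
proof -
  obtain A :: "'a set" where A: "finite A" "rat_vs.span A = UNIV"
    using assms unfolding number_field_def by blast
  obtain B where "B \<subseteq> A" "rat_vs.independent B" "A \<subseteq> rat_vs.span B"
    using rat_vs.maximal_independent_subset by blast
  moreover have "rat_vs.span B = UNIV"
    using A calculation by (metis rat_vs.span_mono rat_vs.span_span top.extremum_unique)
  ultimately have "finite_dimensional_vector_space rat_scale B"
    using A by unfold_locales (auto intro: finite_subset)
  then show thesis by (rule that)
qed

lemma card_le_field_degree:
  fixes S :: "'a::field_char_0 set"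
  assumes "number_field TYPE('a)" "rat_vs.independent S"
  shows "card S \<le> field_degree TYPE('a)"
proof -
  obtain B :: "'a set" where "finite_dimensional_vector_space rat_scale B"
    using number_field_basis[OF assms(1)] .
  then interpret fin: finite_dimensional_vector_space "rat_scale :: rat \<Rightarrow> 'a \<Rightarrow> 'a" B .
  show ?thesis
    unfolding field_degree_def by (rule fin.independent_card_le_dim[OF subset_UNIV assms(2)])
qed

lemma field_degree_pos:
  assumes "number_field TYPE('a::field_char_0)"
  shows "field_degree TYPE('a) > 0"
proof -
  have "rat_vs.independent {1 :: 'a}" by (simp add: rat_vs.dependent_single)
  from card_le_field_degree[OF assms this] show ?thesis by simp
qed

section \<open>Subfields and the tower law\<close>

lemma rat_subspace_mult_image:
  assumes "rat_vs.subspace (K :: 'a::field_char_0 set)"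
  shows "rat_vs.subspace ((\<lambda>y. y * x) ` K)"
  unfolding rat_vs.subspace_def
proof (intro conjI ballI allI)
  show "0 \<in> (\<lambda>y. y * x) ` K"
    using rat_vs.subspace_0[OF assms] by (metis image_eqI mult_zero_left)
  fix a assume a: "a \<in> (\<lambda>y. y * x) ` K"
  then obtain r where r: "r \<in> K" "a = r * x" by blast
  show "rat_scale c a \<in> (\<lambda>y. y * x) ` K" for c
    using r rat_vs.subspace_scale[OF assms r(1), of c]
    by (auto simp: rat_scale_def mult.assoc intro!: image_eqI[of _ _ "rat_scale c r"])
  fix b assume "b \<in> (\<lambda>y. y * x) ` K"
  then obtain s where s: "s \<in> K" "b = s * x" by blast
  show "a + b \<in> (\<lambda>y. y * x) ` K"
    using r s rat_vs.subspace_add[OF assms r(1) s(1)]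
    by (auto simp: distrib_right intro!: image_eqI[of _ _ "r + s"])
qed

lemma rat_dim_mult_image:
  fixes x :: "'a::field_char_0"
  assumes "number_field TYPE('a)" "rat_vs.subspace K" "x \<noteq> 0"
  shows "rat_vs.dim ((\<lambda>y. y * x) ` K) = rat_vs.dim K"
proof -
  obtain B :: "'a set" where "finite_dimensional_vector_space rat_scale B"
    using number_field_basis[OF assms(1)] .
  then interpret fin: finite_dimensional_vector_space "rat_scale :: rat \<Rightarrow> 'a \<Rightarrow> 'a" B .
  interpret pr: finite_dimensional_vector_space_pair rat_scale B rat_scale B ..
  have "Vector_Spaces.linear rat_scale rat_scale (\<lambda>y. y * x)"
    by unfold_locales (auto simp: rat_scale_def algebra_simps)
  moreover have "inj_on (\<lambda>y. y * x) (rat_vs.span K)"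
    using assms(3) by (auto simp: inj_on_def)
  ultimately show ?thesis by (rule pr.dim_image_eq)
qed

text \<open>The tower law for \<open>\<rat> \<subseteq> K \<subseteq> F\<close>: a maximal \<open>K\<close>-subspace whose dimension is a multiple of
  \<open>dim K\<close> must be everything, because any further \<open>K x\<close> meets them trivially.\<close>

lemma dim_subring_dvd_field_degree:
  fixes K :: "'a::field_char_0 set"
  assumes nf: "number_field TYPE('a)" and K: "rat_vs.subspace K"
    and K1: "1 \<in> K" and Kmult: "\<And>x y. x \<in> K \<Longrightarrow> y \<in> K \<Longrightarrow> x * y \<in> K"
  shows "rat_vs.dim K dvd field_degree TYPE('a)"
proof -
  obtain B :: "'a set" where "finite_dimensional_vector_space rat_scale B"
    using number_field_basis[OF nf] .
  then interpret fin: finite_dimensional_vector_space "rat_scale :: rat \<Rightarrow> 'a \<Rightarrow> 'a" B .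
  \<comment> \<open>Multiplication by \<open>q\<close> maps \<open>K\<close> into itself and
    preserves the dimension, so it is onto and hits 1. Hence \<open>K\<close> is a field.\<close>
  have inv: "\<exists>r\<in>K. r * q = 1" if "q \<in> K" "q \<noteq> 0" for q
  proof -
    have "(\<lambda>y. y * q) ` K \<subseteq> K" using Kmult that by blast
    then have "(\<lambda>y. y * q) ` K = K"
      using rat_dim_mult_image[OF nf K that(2)] K rat_subspace_mult_image[OF K]
      by (intro fin.subspace_dim_equal) auto
    then show ?thesis using K1 by (metis imageE)
  qed
  define P where "P = (\<lambda>W::'a set. rat_vs.subspace W \<and> (\<forall>k\<in>K. \<forall>w\<in>W. k * w \<in> W) \<and>
    rat_vs.dim K dvd rat_vs.dim W)"
  have "P {0}" unfolding P_def by auto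
  have "\<forall>W. P W \<longrightarrow> rat_vs.dim W < Suc (rat_vs.dim (UNIV :: 'a set))"
    by (simp add: less_Suc_eq_le fin.dim_subset_UNIV[unfolded fin.dimension_def])
  from ex_has_greatest_nat[of P, OF \<open>P {0}\<close> this]
  obtain W where W: "P W" "\<And>V. P V \<Longrightarrow> rat_vs.dim V \<le> rat_vs.dim W"
    by blast
  have "W = UNIV"
  proof (rule ccontr)
    assume "W \<noteq> UNIV"
    then obtain x where x: "x \<notin> W" by blast
    have Ws: "rat_vs.subspace W" and WK: "\<And>k w. k \<in> K \<Longrightarrow> w \<in> W \<Longrightarrow> k * w \<in> W"
      and Wd: "rat_vs.dim K dvd rat_vs.dim W" using W(1) unfolding P_def by auto
    have x0: "x \<noteq> 0" using x rat_vs.subspace_0[OF Ws] by metis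
    define T where "T = (\<lambda>y. y * x) ` K"
    have T: "rat_vs.subspace T" "rat_vs.dim T = rat_vs.dim K"
      unfolding T_def using rat_subspace_mult_image[OF K] rat_dim_mult_image[OF nf K x0] by auto
    have "W \<inter> T = {0}"
    proof -
      have "q = 0" if q: "q \<in> K" "q * x \<in> W" for q
      proof (rule ccontr)
        assume "q \<noteq> 0"
        then obtain r where r: "r \<in> K" "r * q = 1" using inv q by blast
        then have "r * (q * x) \<in> W" using WK q by blast
        then show False using r(2) x by (simp flip: mult.assoc)
      qed
      then show ?thesis using rat_vs.subspace_0[OF Ws] rat_vs.subspace_0[OF T(1)]
        unfolding T_def by auto
    qed
    define V where "V = {w + t |w t. w \<in> W \<and> t \<in> T}"
    have dV: "rat_vs.dim V = rat_vs.dim W + rat_vs.dim K"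
      using fin.dim_sums_Int[OF Ws T(1)] \<open>W \<inter> T = {0}\<close> T(2) unfolding V_def by simp
    have "P V"
      unfolding P_def
    proof (intro conjI ballI)
      show "rat_vs.subspace V" unfolding V_def by (rule rat_vs.subspace_sums[OF Ws T(1)])
      show "rat_vs.dim K dvd rat_vs.dim V" using dV Wd by simp
      fix k v assume k: "k \<in> K" and "v \<in> V"
      then obtain w s where v: "v = w + s * x" "w \<in> W" "s \<in> K" unfolding V_def T_def by blast
      have "k * v = k * w + (k * s) * x" by (simp add: v algebra_simps)
      then show "k * v \<in> V" unfolding V_def T_def using v k WK Kmult by blast
    qed
    \<comment> \<open>By maximality \<open>V\<close> is no larger than \<open>W\<close>, which
      leaves no room for \<open>K\<close>, although \<open>K\<close> contains 1.\<close>
    then have "rat_vs.dim K = 0" using W(2) dV by force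
    then have "K \<subseteq> {0}" by simp
    then show False using K1 by auto
  qed
  then show ?thesis using W(1) unfolding P_def field_degree_def by simp
qed

subsection \<open>Integer polynomials annihilating an element\<close>

text \<open>The coefficients stay in \<int>, where contents and divisibility by \<open>p\<close>
  make sense; only the value lies in the field.\<close>

definition int_eval :: "int poly \<Rightarrow> 'a::field_char_0 \<Rightarrow> 'a"
  where "int_eval f x = poly (map_poly of_int f) x"

lemma int_eval_pCons [simp]: "int_eval (pCons c f) x = of_int c + x * int_eval f x"
  unfolding int_eval_def by (simp add: map_poly_pCons)

lemma int_eval_0 [simp]: "int_eval 0 x = 0"
  by (simp add: int_eval_def)

lemma int_eval_add [simp]: "int_eval (f + g) x = int_eval f x + int_eval g x"
  by (induction f g rule: poly_induct2) (simp_all add: algebra_simps)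

lemma int_eval_smult [simp]: "int_eval (smult c f) x = of_int c * int_eval f x"
  by (induction f) (simp_all add: algebra_simps)

lemma int_eval_mult [simp]: "int_eval (f * g) x = int_eval f x * int_eval g x"
  by (induction f) (simp_all add: algebra_simps)

lemma int_eval_monom [simp]: "int_eval (monom c n) x = of_int c * x ^ n"
  by (induction n) (simp_all add: monom_0 monom_Suc)

lemma int_eval_sum [simp]: "int_eval (\<Sum>i\<in>I. f i) x = (\<Sum>i\<in>I. int_eval (f i) x)"
  by (induction I rule: infinite_finite_induct) simp_all

lemma int_eval_pcompose [simp]: "int_eval (pcompose f g) x = int_eval f (int_eval g x)"
  by (induction f) (simp_all add: pcompose_pCons)

lemma int_eval_altdef: "int_eval f x = (\<Sum>i\<le>degree f. of_int (coeff f i) * x ^ i)"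
proof -
  have "int_eval f x = int_eval (\<Sum>i\<le>degree f. monom (coeff f i) i) x"
    by (simp add: poly_as_sum_of_monoms)
  then show ?thesis by simp
qed

text \<open>Turns an annihilator of the inverse of \<open>x\<close> into one of \<open>x\<close>,
  with the leading coefficient becoming the constant term.\<close>

lemma int_eval_reflect_poly:
  assumes "x \<noteq> 0"
  shows "int_eval (reflect_poly f) x = x ^ degree f * int_eval f (inverse x)"
proof -
  have "map_poly of_int (reflect_poly f) = reflect_poly (map_poly of_int f :: 'a poly)"
    by (intro poly_eqI) (simp add: coeff_map_poly coeff_reflect_poly degree_map_poly)
  then show ?thesis
    using poly_reflect_poly_nz[OF assms, of "map_poly of_int f"]
    by (simp add: int_eval_def degree_map_poly)
qed

lemma algebraic_int_iff_int_eval: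
  "algebraic_int x \<longleftrightarrow> (\<exists>f. lead_coeff f = 1 \<and> int_eval f x = 0)"
  unfolding algebraic_int_altdef_ipoly int_eval_def by blast

text \<open>By Gauss' lemma, a primitive annihilator of least degree divides all others over \<open>\<int>\<close>.\<close>

lemma primitive_annihilator:
  assumes "g \<noteq> 0" "int_eval g x = 0"
  obtains m where "m \<noteq> 0" "int_eval m x = 0" "\<And>h. int_eval h x = 0 \<Longrightarrow> m dvd h"
proof -
  obtain f where f: "f \<noteq> 0" "int_eval f x = 0"
    and least: "\<And>h. h \<noteq> 0 \<Longrightarrow> int_eval h x = 0 \<Longrightarrow> degree f \<le> degree h"
    using ex_has_least_nat[of "\<lambda>f. f \<noteq> 0 \<and> int_eval f x = 0" g degree] assms by blast
  define m where "m = primitive_part f"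
  have fm: "f = smult (content f) m" unfolding m_def by simp
  have m0: "m \<noteq> 0" using f by (simp add: m_def)
  have "of_int (content f) * int_eval m x = 0"
    using f(2) fm by (metis int_eval_smult)
  then have mx: "int_eval m x = 0" using f by simp
  have "m dvd h" if h: "int_eval h x = 0" for h
  proof -
    obtain c q where c: "c \<noteq> 0" "smult c h = m * q + pseudo_mod h m"
      using pseudo_mod(1)[OF m0, of h] by blast
    \<comment> \<open>A nonzero pseudo-remainder would be an annihilator of smaller degree than
      \<open>m\<close>.\<close>
    have "int_eval (pseudo_mod h m) x = 0"
      using arg_cong[OF c(2), of "\<lambda>f. int_eval f x"] h mx by simp
    moreover have "degree m = degree f" by (simp add: m_def)
    ultimately have "pseudo_mod h m = 0"
      using pseudo_mod(2)[OF m0, of h] least[of "pseudo_mod h m"] by force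
    with c have eq: "smult c h = m * q" by simp
    \<comment> \<open>Contents are multiplicative and \<open>m\<close> is primitive, so the factor
      \<open>c\<close> brought in by pseudo-division divides \<open>q\<close> and cancels.\<close>
    have "content m = 1" using f by (simp add: m_def)
    then have "content q = content (smult c h)" by (simp add: eq content_mult)
    then have "[:c:] dvd q"
      by (simp add: const_poly_dvd_iff_dvd_content)
    then obtain r where "q = smult c r" by (auto elim: dvdE)
    with eq have "smult c (h - m * r) = 0" by (simp add: smult_diff_right)
    with c(1) show ?thesis by auto
  qed
  with m0 mx show thesis by (rule that)
qed

section \<open>The degree of a simple extension\<close>

text \<open>Up to a constant factor, \<open>m\<close> is the minimal polynomial of \<open>x\<close>,
  and the span is \<open>\<rat>(x)\<close>; the powers of \<open>x\<close> below
  \<open>degree m\<close> form a basis.\<close>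

lemma dim_span_powers:
  fixes x :: "'a::field_char_0"
  assumes "m \<noteq> 0" "int_eval m x = 0" and min: "\<And>h. int_eval h x = 0 \<Longrightarrow> m dvd h"
  shows "rat_vs.dim (rat_vs.span (range (\<lambda>i. x ^ i))) = degree m"
proof -
  define d where "d = degree m"
  define S where "S = (\<lambda>i. x ^ i) ` {..<d}"
  have "\<not> (\<not> inj_on (\<lambda>i. x ^ i) {..<d} \<or> rat_vs.dependent S)"
  proof
    assume "\<not> inj_on (\<lambda>i. x ^ i) {..<d} \<or> rat_vs.dependent S"
    then obtain c :: "nat \<Rightarrow> int" and j
      where c: "(\<Sum>i<d. of_int (c i) * x ^ i) = 0" "j < d" "c j \<noteq> 0"
      using integer_relation[of "{..<d}" "\<lambda>i. x ^ i"] unfolding S_def by auto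
    \<comment> \<open>A relation between these powers is a nonzero annihilator of degree below
      \<open>d\<close>, which \<open>m\<close> cannot divide.\<close>
    define h where "h = (\<Sum>i<d. monom (c i) i)"
    have "coeff h i = (if i < d then c i else 0)" for i
      unfolding h_def by (simp add: coeff_sum)
    then have "h \<noteq> 0" "degree h \<le> d - 1"
      using c by (metis coeff_0, intro degree_le) auto
    moreover have "int_eval h x = 0" using c unfolding h_def by simp
    ultimately show False using min[of h] dvd_imp_degree_le[of m h] c(2) unfolding d_def by force
  qed
  then have inj: "inj_on (\<lambda>i. x ^ i) {..<d}" and ind: "rat_vs.independent S" by auto
  have "x ^ i \<in> rat_vs.span S" for i
  proof (induction i rule: less_induct)
    case (less i)
    show ?case
    proof (cases "i < d")
      case True
      then show ?thesis by (auto simp: S_def intro: rat_vs.span_base)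
    next
      case False
      \<comment> \<open>As \<open>m\<close> may fail to be monic, the relation
        \<open>m(x) = 0\<close> is multiplied by \<open>x ^ (i - d)\<close> and then divided by
        \<open>l\<close>.\<close>
      define l where "l = lead_coeff m"
      have l0: "of_int l \<noteq> (0 :: 'a)" using assms by (simp add: l_def)
      have "(\<Sum>j<d. of_int (coeff m j) * x ^ j) + of_int l * x ^ d = 0"
        using assms(2) unfolding int_eval_altdef l_def d_def
        by (simp flip: lessThan_Suc_atMost)
      then have "x ^ (i - d) * (of_int l * x ^ d) = x ^ (i - d) * - (\<Sum>j<d. of_int (coeff m j) * x ^ j)"
        by (simp add: add_eq_0_iff)
      moreover have "x ^ i = x ^ (i - d) * x ^ d" using False by (simp flip: power_add)
      ultimately have "of_int l * x ^ i = - (x ^ (i - d) * (\<Sum>j<d. of_int (coeff m j) * x ^ j))"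
        by (simp add: mult_ac)
      also have "\<dots> = (\<Sum>j<d. rat_scale (of_int (- coeff m j)) (x ^ (i - d + j)))"
        by (simp add: sum_distrib_left rat_scale_def power_add mult_ac sum_negf of_rat_minus)
      also have "\<dots> \<in> rat_vs.span S"
        using False by (intro rat_vs.span_sum rat_vs.span_scale less) auto
      finally have "rat_scale (1 / of_int l) (of_int l * x ^ i) \<in> rat_vs.span S"
        by (rule rat_vs.span_scale)
      moreover have "rat_scale (1 / of_int l) (of_int l * x ^ i) = x ^ i"
        using l0 by (simp add: rat_scale_def of_rat_divide)
      ultimately show ?thesis by simp
    qed
  qed
  then have "rat_vs.span (range (\<lambda>i. x ^ i)) = rat_vs.span S"
    by (intro rat_vs.span_eq[THEN iffD2] conjI)
       (auto simp: S_def intro: rat_vs.span_base)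
  then have "rat_vs.dim (rat_vs.span (range (\<lambda>i. x ^ i))) = card S"
    using ind by (metis rat_vs.dim_span rat_vs.dim_eq_card_independent)
  also have "\<dots> = d" unfolding S_def by (simp add: card_image inj)
  finally show ?thesis by (simp add: d_def)
qed

text \<open>Products of powers are powers; linearity in one factor and then in the other extends
  this to the span.\<close>

lemma span_powers_mult:
  fixes x :: "'a::field_char_0"
  assumes "a \<in> rat_vs.span (range (\<lambda>i. x ^ i))" "b \<in> rat_vs.span (range (\<lambda>i. x ^ i))"
  shows "a * b \<in> rat_vs.span (range (\<lambda>i. x ^ i))"
proof -
  let ?K = "rat_vs.span (range (\<lambda>i. x ^ i))"
  have closed: "rat_vs.subspace {a. a * b \<in> ?K}" for b
    unfolding rat_vs.subspace_def
    using rat_vs.span_add[of _ "range (\<lambda>i. x ^ i)"] rat_vs.span_scale[of _ "range (\<lambda>i. x ^ i)"]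
      rat_vs.span_zero[of "range (\<lambda>i. x ^ i)"]
    by (auto simp: distrib_right rat_scale_def mult.assoc)
  have pow: "x ^ i * b \<in> ?K" if "b \<in> ?K" for i b
  proof -
    have "range (\<lambda>i. x ^ i) \<subseteq> {b. b * x ^ i \<in> ?K}"
      by (auto simp flip: power_add intro: rat_vs.span_base)
    then have "?K \<subseteq> {b. b * x ^ i \<in> ?K}" using closed by (rule rat_vs.span_minimal)
    then show ?thesis using that by (auto simp: mult.commute)
  qed
  have "range (\<lambda>i. x ^ i) \<subseteq> {a. a * b \<in> ?K}" using pow assms(2) by auto
  then have "?K \<subseteq> {a. a * b \<in> ?K}" using closed by (rule rat_vs.span_minimal)
  then show ?thesis using assms(1) by auto
qed

text \<open>Unique factorisation of \<open>X\<^sup>N\<close> in \<open>\<bbbF>\<^sub>p[X]\<close>, phrased over \<open>\<int>\<close>.\<close>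

lemma prime_dvd_coeff_factor:
  fixes f g :: "int poly"
  assumes p: "Factorial_Ring.prime p" and lc: "lead_coeff (f * g) = 1"
    and low: "\<And>i. i < degree (f * g) \<Longrightarrow> p dvd coeff (f * g) i"
    and i: "i < degree f"
  shows "p dvd coeff f i"
proof -
  have nz: "f \<noteq> 0" "g \<noteq> 0" using lc by auto
  have lcs: "lead_coeff f * lead_coeff g = 1" using lc by (simp add: lead_coeff_mult)
  have np: "\<not> p dvd 1" using p not_prime_unit by blast
  have f: "\<not> p dvd lead_coeff f" and g: "\<not> p dvd lead_coeff g"
    using lcs np by (metis dvd_mult2, metis dvd_mult)
  \<comment> \<open>Modulo \<open>p\<close>, the coefficient of \<open>f * g\<close> at
    \<open>s + t\<close> is the product of those of \<open>f\<close> at \<open>s\<close> and of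
    \<open>g\<close> at \<open>t\<close>. It is nonzero, so \<open>s + t\<close> must be the full
    degree.\<close>
  define s where "s = (LEAST k. \<not> p dvd coeff f k)"
  define t where "t = (LEAST k. \<not> p dvd coeff g k)"
  have s: "\<not> p dvd coeff f s" "\<And>k. k < s \<Longrightarrow> p dvd coeff f k"
    unfolding s_def using f by (rule LeastI, blast dest: not_less_Least)
  have t: "\<not> p dvd coeff g t" "\<And>k. k < t \<Longrightarrow> p dvd coeff g k"
    unfolding t_def using g by (rule LeastI, blast dest: not_less_Least)
  have sd: "s \<le> degree f" and td: "t \<le> degree g"
    using s(1) t(1) by (metis coeff_eq_0 dvd_0_right not_le)+
  have "p dvd (\<Sum>k\<in>{..s+t} - {s}. coeff f k * coeff g (s + t - k))"
  proof (rule dvd_sum)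
    fix k assume "k \<in> {..s+t} - {s}"
    then consider "k < s" | "s + t - k < t" by force
    then show "p dvd coeff f k * coeff g (s + t - k)" using s(2) t(2) by cases auto
  qed
  moreover have "coeff (f * g) (s + t)
      = coeff f s * coeff g t + (\<Sum>k\<in>{..s+t} - {s}. coeff f k * coeff g (s + t - k))"
    unfolding coeff_mult by (subst sum.remove[of _ s]) auto
  moreover have "\<not> p dvd coeff f s * coeff g t"
    using s(1) t(1) p by (simp add: prime_dvd_mult_iff)
  ultimately have "\<not> p dvd coeff (f * g) (s + t)"
    by (simp add: dvd_add_left_iff)
  then have "degree (f * g) \<le> s + t" using low by (meson not_le)
  then have "s = degree f" using sd td nz by (simp add: degree_mult_eq)
  then show ?thesis using s(2) i by simp
qed

text \<open>With \<open>y = x\<^sup>n / p\<close> for \<open>x = w - a\<close>, a monic relation \<open>\<Sum>\<^sub>i f\<^sub>i y\<^sup>i = 0\<close> of degree \<open>b\<close> yields the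
  annihilator \<open>h = \<Sum>\<^sub>i f\<^sub>i p\<^sup>b\<^sup>-\<^sup>i X\<^sup>n\<^sup>i\<close> of \<open>x\<close>, which is \<open>X\<^sup>n\<^sup>b\<close> modulo \<open>p\<close>. The minimal polynomial
  divides \<open>h\<close>, and it also divides a shift of the reversed monic annihilator of \<open>1 / w\<close>, whose
  value at \<open>-a\<close> is 1.\<close>

lemma unit_power_cong:
  fixes w :: "'a::field_char_0"
  assumes nf: "number_field TYPE('a)" and p: "Factorial_Ring.prime p" and n: "n > 0"
    and w: "w \<noteq> 0" "algebraic_int (inverse w)"
    and ai: "algebraic_int ((w - of_int a) ^ n / of_nat p)"
  shows "\<exists>d. d dvd field_degree TYPE('a) \<and> [a ^ (2 * d) = 1] (mod int p)"
proof -
  define x where "x = w - of_int a"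
  define y where "y = x ^ n / of_nat p"
  have p0: "p > 0" using p by (rule prime_gt_0_nat)
  have xy: "x ^ n = of_nat p * y" using p0 by (simp add: y_def)
  obtain f where f: "lead_coeff f = 1" "int_eval f y = 0"
    using ai unfolding x_def[symmetric] y_def[symmetric] algebraic_int_iff_int_eval by blast
  define b where "b = degree f"
  define h where "h = (\<Sum>i\<le>b. monom (coeff f i * int p ^ (b - i)) (n * i))"
  have coeff_h: "coeff h k = (\<Sum>i\<le>b. if n * i = k then coeff f i * int p ^ (b - i) else 0)" for k
    unfolding h_def by (simp add: coeff_sum)
  have "int_eval h x = (\<Sum>i\<le>b. of_nat p ^ b * (of_int (coeff f i) * y ^ i))"
    unfolding h_def int_eval_sum int_eval_monom
  proof (rule sum.cong)
    fix i assume i: "i \<in> {..b}"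
    then have "(of_nat p :: 'a) ^ b = of_nat p ^ (b - i) * of_nat p ^ i" by (simp flip: power_add)
    moreover have "x ^ (n * i) = of_nat p ^ i * y ^ i"
      by (simp add: power_mult xy power_mult_distrib)
    ultimately show "of_int (coeff f i * int p ^ (b - i)) * x ^ (n * i) =
        of_nat p ^ b * (of_int (coeff f i) * y ^ i)"
      by (simp add: mult_ac)
  qed simp
  also have "\<dots> = 0" using f(2) by (simp add: int_eval_altdef b_def flip: sum_distrib_left)
  finally have hx: "int_eval h x = 0" .
  have "coeff h (n * b) = (\<Sum>i\<le>b. if i = b then coeff f i * int p ^ (b - i) else 0)"
    unfolding coeff_h using n by (intro sum.cong) auto
  then have hb: "coeff h (n * b) = 1" using f(1) by (simp add: b_def)
  moreover have "coeff h k = 0" if "k > n * b" for k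
    unfolding coeff_h
  proof (intro sum.neutral ballI)
    fix i assume "i \<in> {..b}"
    then have "n * i \<le> n * b" by simp
    then have "n * i \<noteq> k" using that by linarith
    then show "(if n * i = k then coeff f i * int p ^ (b - i) else 0) = 0" by simp
  qed
  ultimately have deg: "degree h = n * b"
    by (metis degree_le le_antisym le_degree one_neq_zero)
  have low: "int p dvd coeff h k" if "k < degree h" for k
    unfolding coeff_h
  proof (rule dvd_sum)
    fix i assume "i \<in> {..b}"
    show "int p dvd (if n * i = k then coeff f i * int p ^ (b - i) else 0)"
    proof (cases "n * i = k")
      case True
      then have "n * i < n * b" using that deg by simp
      then have "i < b" by simp
      then show ?thesis by (simp add: dvd_power)
    qed simp
  qed
  have "h \<noteq> 0" using hb by auto
  then obtain m where m: "m \<noteq> 0" "int_eval m x = 0" "\<And>h. int_eval h x = 0 \<Longrightarrow> m dvd h"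
    using primitive_annihilator[OF _ hx] by blast
  define d where "d = degree m"
  let ?K = "rat_vs.span (range (\<lambda>i. x ^ i))"
  have "(1 :: 'a) \<in> ?K" by (intro rat_vs.span_base) (metis power_0 rangeI)
  then have dn: "d dvd field_degree TYPE('a)"
    using dim_subring_dvd_field_degree[OF nf rat_vs.subspace_span, of "range (\<lambda>i. x ^ i)"]
      span_powers_mult dim_span_powers[OF m] unfolding d_def by metis
  obtain q where q: "h = m * q" using m(3)[OF hx] by blast
  \<comment> \<open>Since \<open>h\<close> is monic, the leading coefficient of \<open>m\<close> is
    1 or -1.\<close>
  have lm: "lead_coeff m * lead_coeff q = 1"
    using hb deg q by (simp add: lead_coeff_mult[symmetric])
  have low_m: "int p dvd coeff m i" if "i < d" for i
    using prime_dvd_coeff_factor[of "int p" m q i] p low hb deg that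
    unfolding q d_def by (metis prime_nat_int_transfer)
  obtain g where g: "lead_coeff g = 1" "int_eval g (inverse w) = 0"
    using w unfolding algebraic_int_iff_int_eval by blast
  define r where "r = pcompose (reflect_poly g) [:a, 1:]"
  have "int_eval r x = int_eval (reflect_poly g) w"
    unfolding r_def by (simp add: x_def)
  also have "\<dots> = 0" using g w by (simp add: int_eval_reflect_poly)
  finally obtain s where s: "r = m * s" using m(3) by blast
  \<comment> \<open>The shift sends \<open>-a\<close> to 0, where the reversal of the monic
    \<open>g\<close> is 1. As \<open>m\<close> divides \<open>r\<close>, its value at
    \<open>-a\<close> is 1 or -1.\<close>
  have "poly r (-a) = 1" unfolding r_def by (simp add: poly_pcompose poly_0_coeff_0 g(1))
  then have unit: "poly m (-a) * poly s (-a) = 1" by (simp add: s)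
  have "[(\<Sum>i<d. coeff m i * (-a) ^ i) = 0] (mod int p)"
    using low_m by (auto simp: cong_0_iff intro!: dvd_sum)
  then have "[(\<Sum>i<d. coeff m i * (-a) ^ i) + lead_coeff m * (-a) ^ d = 0 + lead_coeff m * (-a) ^ d] (mod int p)"
    by (intro cong_add cong_refl)
  moreover have "poly m (-a) = (\<Sum>i<d. coeff m i * (-a) ^ i) + lead_coeff m * (-a) ^ d"
    unfolding poly_altdef d_def by (simp flip: lessThan_Suc_atMost)
  \<comment> \<open>Squaring removes the signs of \<open>poly m (-a)\<close>, of the leading
    coefficient and of \<open>(-a) ^ d\<close>.\<close>
  ultimately have "[poly m (-a) ^ 2 = (lead_coeff m * (-a) ^ d) ^ 2] (mod int p)"
    by (intro cong_pow) simp
  moreover have "poly m (-a) ^ 2 = 1" "lead_coeff m ^ 2 = 1"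
    using unit lm by (auto simp: zmult_eq_1_iff)
  ultimately have "[1 = ((-a) ^ d) ^ 2] (mod int p)" by (simp add: power_mult_distrib)
  moreover have "((-a) ^ d) ^ 2 = a ^ (2 * d)"
    by (simp add: power_mult[symmetric] mult.commute[of d 2] power_minus_even)
  ultimately show ?thesis using dn cong_sym by metis
qed

subsection \<open>Totally ramified primes\<close>

lemma ring_of_integers_simps [simp]:
  "carrier (ring_of_integers TYPE('a::field_char_0)) = {x :: 'a. algebraic_int x}"
  "x \<otimes>\<^bsub>ring_of_integers TYPE('a)\<^esub> y = x * y"
  "x \<oplus>\<^bsub>ring_of_integers TYPE('a)\<^esub> y = x + y"
  "\<one>\<^bsub>ring_of_integers TYPE('a)\<^esub> = 1"
  "\<zero>\<^bsub>ring_of_integers TYPE('a)\<^esub> = 0"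
  by (simp_all add: ring_of_integers_def ring_of_type_algebra_def)

text \<open>The chain of powers \<open>Q i = P\<^sup>i\<close> of a prime ideal with \<open>p \<O> = P\<^sup>n\<close>.\<close>

locale ramification_filtration =
  fixes Q :: "nat \<Rightarrow> 'a::field_char_0 set" and n p :: nat
  assumes Q_0: "Q 0 = {x. algebraic_int x}"
    and Q_zero: "0 \<in> Q i"
    and Q_add: "x \<in> Q i \<Longrightarrow> y \<in> Q i \<Longrightarrow> x + y \<in> Q i"
    and Q_mult: "algebraic_int r \<Longrightarrow> x \<in> Q i \<Longrightarrow> r * x \<in> Q i"
    and Q_Suc: "Q (Suc i) \<subseteq> Q i"
    and Q_strict: "i < n \<Longrightarrow> Q (Suc i) \<noteq> Q i"
    and Q_power: "x \<in> Q 1 \<Longrightarrow> x ^ i \<in> Q i"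
    and Q_n: "x \<in> Q n \<longleftrightarrow> algebraic_int (x / of_nat p)"
    and one_notin_Q_1: "1 \<notin> Q 1"
    and p: "Factorial_Ring.prime p"
begin

lemma Q_of_int_mult: "x \<in> Q i \<Longrightarrow> of_int k * x \<in> Q i"
  by (rule Q_mult) simp_all

lemma Q_uminus: "x \<in> Q i \<Longrightarrow> - x \<in> Q i"
  using Q_of_int_mult[of x i "-1"] by simp

lemma Q_sum: "(\<And>j. j \<in> J \<Longrightarrow> f j \<in> Q i) \<Longrightarrow> sum f J \<in> Q i"
  by (induction J rule: infinite_finite_induct) (auto intro: Q_zero Q_add)

lemma Q_antimono: "i \<le> j \<Longrightarrow> Q j \<subseteq> Q i"
  by (rule lift_Suc_antimono_le[of Q]) (rule Q_Suc)

lemma Q_algebraic_int: "x \<in> Q i \<Longrightarrow> algebraic_int x"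
  using Q_antimono[of 0 i] Q_0 by auto

text \<open>\<open>Q n\<close> is \<open>p \<O>\<close>, and it lies in every earlier member of the
  chain.\<close>

lemma dvd_mult_mem_Q:
  assumes "algebraic_int x" "int p dvd k" "i \<le> n"
  shows "of_int k * x \<in> Q i"
proof -
  obtain l where k: "k = int p * l" using assms by blast
  have "p > 0" using p by (rule prime_gt_0_nat)
  have "of_int l * x \<in> Q 0" using assms Q_0 by (intro Q_of_int_mult) simp
  then have "of_int k * x \<in> Q n" using \<open>p > 0\<close> Q_0 by (simp add: Q_n k)
  then show ?thesis using Q_antimono[OF assms(3)] by blast
qed

lemma Bezout_p:
  assumes "\<not> int p dvd k"
  obtains u v where "u * k + v * int p = 1"
proof -
  have "coprime (int p) k" using p assms by (simp add: prime_imp_coprime)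
  then have "gcd k (int p) = 1" by (simp add: coprime_iff_gcd_eq_1 gcd.commute)
  then show thesis using bezout_int[of k "int p"] that by metis
qed

text \<open>For \<open>i < n\<close> the quotient of \<open>Q i\<close> by \<open>Q (Suc i)\<close>
  is killed by \<open>p\<close>, so an integer prime to \<open>p\<close> acts invertibly on
  it.\<close>

lemma dvd_if_mult_mem_Q_Suc:
  assumes "i < n" "x \<in> Q i" "x \<notin> Q (Suc i)" "of_int k * x \<in> Q (Suc i)"
  shows "int p dvd k"
proof (rule ccontr)
  assume "\<not> int p dvd k"
  then obtain u v where uv: "u * k + v * int p = 1" by (rule Bezout_p)
  have "of_int u * (of_int k * x) + of_int (v * int p) * x \<in> Q (Suc i)"
    using assms(1) Q_algebraic_int[OF assms(2)]
    by (intro Q_add[OF Q_of_int_mult[OF assms(4)] dvd_mult_mem_Q]) simp_all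
  moreover have "of_int u * (of_int k * x) + of_int (v * int p) * x = of_int (u * k + v * int p) * x"
    by (simp add: algebra_simps)
  ultimately show False using assms(3) uv by simp
qed

lemma of_int_mem_Q_1:
  assumes "of_int k \<in> Q 1" "n > 0"
  shows "int p dvd k"
  using dvd_if_mult_mem_Q_Suc[of 0 1 k] assms one_notin_Q_1 by (simp add: Q_0)

text \<open>The residue field is \<open>\<bbbF>\<^sub>p\<close>: choosing \<open>\<pi>\<^sub>i \<in> Q i - Q (i + 1)\<close> for \<open>0 < i < n\<close>, the \<open>n + 1\<close>
  elements \<open>1, \<pi>\<^sub>1, \<dots>, \<pi>\<^sub>n\<^sub>-\<^sub>1, x\<close> satisfy an integer relation that is primitive at \<open>p\<close>; if \<open>x\<close>
  were not congruent to an integer, all its coefficients would be divisible by \<open>p\<close>.\<close>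

lemma residue_integer:
  assumes nf: "number_field TYPE('a)" and n: "n = field_degree TYPE('a)" "n > 0"
    and x: "algebraic_int x"
  shows "\<exists>a. x - of_int a \<in> Q 1"
proof (rule ccontr)
  assume contra: "\<nexists>a. x - of_int a \<in> Q 1"
  have "\<exists>z. z \<in> Q i \<and> z \<notin> Q (Suc i)" if "i < n" for i
    using Q_Suc[of i] Q_strict[OF that] by blast
  then obtain z where z: "\<And>i. i < n \<Longrightarrow> z i \<in> Q i \<and> z i \<notin> Q (Suc i)" by metis
  define y where "y = (\<lambda>i. if i = n then x else if i = 0 then 1 else z i)"
  have y: "y i \<in> Q i" "y i \<notin> Q (Suc i)" if "i < n" for i
    using z[OF that] that one_notin_Q_1 by (auto simp: y_def Q_0)
  have yn: "y n = x" by (simp add: y_def)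
  have yai: "algebraic_int (y i)" if "i \<le> n" for i
    using y(1)[of i] Q_algebraic_int x yn that by (cases "i = n") auto
  have "\<not> inj_on y {..n} \<or> rat_vs.dependent (y ` {..n})"
  proof (cases "inj_on y {..n}")
    case True
    then have "card (y ` {..n}) = Suc n" by (simp add: card_image)
    then show ?thesis using card_le_field_degree[OF nf, of "y ` {..n}"] n(1) by linarith
  qed simp
  then obtain c where c: "(\<Sum>i\<le>n. of_int (c i) * y i) = 0" "\<exists>i\<in>{..n}. \<not> int p dvd c i"
    using primitive_integer_relation[OF finite_atMost _ prime_gt_1_nat[OF p]] by blast
  have split: "of_int (c i) * y i = - (\<Sum>j\<in>{..n} - {i}. of_int (c j) * y j)" if "i \<le> n" for i
    using c(1) that sum.remove[of "{..n}" i "\<lambda>i. of_int (c i) * y i"]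
    by (simp add: add_eq_0_iff2)
  \<comment> \<open>Otherwise the relation can be solved for \<open>x\<close> modulo
    \<open>Q 1\<close>. The terms with \<open>0 < j < n\<close> vanish there, so \<open>x\<close> is
    congruent to an integer.\<close>
  have cn: "int p dvd c n"
  proof (rule ccontr)
    assume "\<not> int p dvd c n"
    then obtain u v where uv: "u * c n + v * int p = 1" by (rule Bezout_p)
    have "(\<Sum>j\<in>{..n} - {n}. of_int (c j) * y j) = of_int (c 0) * y 0 +
        (\<Sum>j\<in>{..n} - {n} - {0}. of_int (c j) * y j)"
      using n(2) by (intro sum.remove) auto
    then have "of_int (c n) * x + of_int (c 0) = - (\<Sum>j\<in>{..n} - {n} - {0}. of_int (c j) * y j)"
      using split[of n] n(2) by (simp add: y_def)
    also have "\<dots> \<in> Q 1"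
    proof (intro Q_uminus Q_sum Q_of_int_mult)
      fix j assume "j \<in> {..n} - {n} - {0}"
      then have "j < n" "1 \<le> j" by auto
      then show "y j \<in> Q 1" using y(1) Q_antimono by blast
    qed
    finally have "of_int (c n) * x + of_int (c 0) \<in> Q 1" .
    then have "of_int u * (of_int (c n) * x + of_int (c 0)) + of_int (v * int p) * x \<in> Q 1"
      using x n(2) by (intro Q_add[OF Q_of_int_mult dvd_mult_mem_Q]) simp_all
    also have "of_int u * (of_int (c n) * x + of_int (c 0)) + of_int (v * int p) * x =
        of_int (u * c n + v * int p) * x - of_int (- u * c 0)"
      by (simp add: algebra_simps)
    finally have "x - of_int (- u * c 0) \<in> Q 1" using uv by simp
    then show False using contra by blast
  qed
  \<comment> \<open>Upward induction: modulo \<open>Q (Suc i)\<close> the terms with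
    \<open>j < i\<close> or \<open>j = n\<close> vanish because \<open>p\<close> divides their
    coefficients, and those with \<open>i < j < n\<close> because \<open>y j\<close> lies in
    \<open>Q (Suc i)\<close>.\<close>
  have "int p dvd c i" if "i < n" for i
    using that
  proof (induction i rule: less_induct)
    case (less i)
    have "of_int (c i) * y i = - (\<Sum>j\<in>{..n} - {i}. of_int (c j) * y j)"
      using less.prems by (intro split) simp
    also have "\<dots> \<in> Q (Suc i)"
    proof (intro Q_uminus Q_sum)
      fix j assume j: "j \<in> {..n} - {i}"
      show "of_int (c j) * y j \<in> Q (Suc i)"
      proof (cases "j < i \<or> j = n")
        case True
        then have "int p dvd c j" using less cn by auto
        then show ?thesis using j less.prems by (intro dvd_mult_mem_Q yai) auto
      next
        case False
        then have "j < n" "Suc i \<le> j" using j by auto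
        then have "y j \<in> Q (Suc i)" using y(1) Q_antimono by blast
        then show ?thesis by (rule Q_of_int_mult)
      qed
    qed
    finally show ?case using less.prems y by (intro dvd_if_mult_mem_Q_Suc[of i "y i"])
  qed
  then show False using c(2) cn by (metis atMost_iff le_neq_implies_less)
qed

end

section \<open>Powers of the ramified prime ideal\<close>

lemma totally_ramified_filtration:
  assumes ram: "totally_ramified TYPE('a) p" and p: "Factorial_Ring.prime p"
  obtains Q :: "nat \<Rightarrow> 'a::field_char_0 set" where "ramification_filtration Q (field_degree TYPE('a)) p"
proof -
  define R where "R = ring_of_integers TYPE('a)"
  define n where "n = field_degree TYPE('a)"
  obtain P where P: "primeideal P R"
    and eq: "PIdl\<^bsub>R\<^esub> (of_nat p) = P [^]\<^bsub>ideals_set R\<^esub> n"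
    using ram unfolding totally_ramified_def R_def n_def by blast
  interpret primeideal P R by fact
  interpret pow: comm_monoid "ideals_set R" by (rule ideals_set_is_comm_monoid)
  have R: "carrier R = {x. algebraic_int x}" "\<And>x y. x \<otimes>\<^bsub>R\<^esub> y = x * y"
    "\<And>x y. x \<oplus>\<^bsub>R\<^esub> y = x + y" "\<one>\<^bsub>R\<^esub> = 1" "\<zero>\<^bsub>R\<^esub> = 0"
    by (simp_all add: R_def)
  have I: "carrier (ideals_set R) = {I. ideal I R}" "\<And>I J. I \<otimes>\<^bsub>ideals_set R\<^esub> J = I \<cdot>\<^bsub>R\<^esub> J"
    "\<one>\<^bsub>ideals_set R\<^esub> = carrier R"
    by (simp_all add: ideals_set_def)
  define Q where "Q = (\<lambda>i::nat. P [^]\<^bsub>ideals_set R\<^esub> i)"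
  have PI: "ideal P R" by (rule is_ideal)
  have QI: "ideal (Q i) R" for i
    using pow.nat_pow_closed[of P i] PI unfolding Q_def I by simp
  have Q0: "Q 0 = carrier R" by (simp add: Q_def I)
  have QS: "Q (Suc i) = Q i \<cdot>\<^bsub>R\<^esub> P" for i by (simp add: Q_def I)
  have Q1: "Q 1 = P" using pow.nat_pow_eone[of P] PI by (simp add: Q_def I)
  have one: "1 \<notin> P" using one_imp_carrier I_notcarr by (auto simp: R)
  have p0: "of_nat p \<noteq> (0 :: 'a)" using p by (simp add: prime_gt_0_nat)
  have Qn: "Q n = {x * of_nat p |x. algebraic_int x}"
    using eq by (simp add: Q_def cgenideal_def R)
  show thesis
  proof (rule that, unfold_locales)
    fix i :: nat and x y :: 'a
    interpret Qi: ideal "Q i" R by (rule QI)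
    show "Q 0 = {x. algebraic_int x}" by (simp add: Q0 R)
    show "0 \<in> Q i" using Qi.zero_closed by (simp add: R)
    show "x + y \<in> Q i" if "x \<in> Q i" "y \<in> Q i" using Qi.a_closed[OF that] by (simp add: R)
    show "r * x \<in> Q i" if "algebraic_int r" "x \<in> Q i" for r
      using Qi.I_l_closed[OF that(2), of r] that by (simp add: R)
    show "Q (Suc i) \<subseteq> Q i" using ideal_prod_inter[OF QI PI, of i] by (auto simp: QS)
    show "Q (Suc i) \<noteq> Q i" if "i < field_degree TYPE('a)"
    proof
      assume same: "Q (Suc i) = Q i"
      \<comment> \<open>Two equal consecutive powers make the chain stationary, so the powers at
        \<open>n\<close> and \<open>n + 1\<close> agree. Then \<open>p\<close> lies in
        \<open>p P\<close>, and cancelling \<open>p\<close> puts 1 into \<open>P\<close>.\<close>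
      have "Q (i + j) = Q i" for j
        by (induction j) (use same in \<open>simp_all add: QS\<close>)
      from this[of "n - i"] this[of "Suc n - i"] have "Q (Suc n) = Q n"
        using that by (simp add: n_def)
      then have "1 * of_nat p \<in> Q n \<cdot>\<^bsub>R\<^esub> P" unfolding QS Qn by force
      \<comment> \<open>Every element of the product of \<open>p \<O>\<close> and \<open>P\<close>
        is \<open>p\<close> times an element of \<open>P\<close>; the induction runs over products
        and their sums.\<close>
      then have "\<exists>z\<in>P. 1 * of_nat p = z * of_nat p"
      proof (induction rule: ideal_prod.induct)
        case (prod s t)
        obtain r where "s = r * of_nat p" "algebraic_int r"
          using prod(1) unfolding Qn by blast
        moreover have "r * t \<in> P"
          using I_l_closed[OF prod(2), of r] \<open>algebraic_int r\<close> unfolding R by blast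
        ultimately show ?case unfolding R by (intro bexI[of _ "r * t"]) (simp add: mult_ac)
      next
        case (sum s t)
        from sum.IH obtain z1 z2 where z: "z1 \<in> P" "z2 \<in> P"
          and "s = z1 * of_nat p" "t = z2 * of_nat p" by auto
        then have "s + t = (z1 + z2) * of_nat p" by (simp add: distrib_right)
        moreover have "z1 + z2 \<in> P" using additive_subgroup.a_closed[OF ideal.axioms(1)[OF PI] z] unfolding R .
        ultimately show ?case unfolding R by blast
      qed
      then obtain z where "z \<in> P" "1 * of_nat p = z * of_nat p" by blast
      then show False using p0 one by simp
    qed
    show "x ^ i \<in> Q i" if "x \<in> Q 1"
    proof (induction i)
      case (Suc i)
      have "x \<in> P" using that unfolding Q1 .
      from ideal_prod.prod[OF Suc this, of R] show ?case
        unfolding QS R by (simp add: mult.commute)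
    qed (simp add: Q0 R)
    show "x \<in> Q (field_degree TYPE('a)) \<longleftrightarrow> algebraic_int (x / of_nat p)"
    proof
      assume "x \<in> Q (field_degree TYPE('a))"
      then show "algebraic_int (x / of_nat p)" using p0 unfolding n_def[symmetric] Qn by auto
    next
      assume "algebraic_int (x / of_nat p)"
      moreover have "x = x / of_nat p * of_nat p" using p0 by simp
      ultimately show "x \<in> Q (field_degree TYPE('a))"
        unfolding n_def[symmetric] Qn by blast
    qed
    show "1 \<notin> Q 1" using one Q1 by simp
    show "Factorial_Ring.prime p" by fact
  qed
qed

section \<open>Residues of units and the unit equation\<close>

text \<open>The order of \<open>a\<close> modulo \<open>p\<close> divides \<open>2 * d\<close> and,
  by Fermat, \<open>p - 1\<close>. Their gcd is 2, so \<open>a ^ 2\<close> is 1 modulo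
  \<open>p\<close>.\<close>

lemma cong_1_or_minus_1_if_power_cong_1:
  fixes a :: int and p d :: nat
  assumes p: "Factorial_Ring.prime p" "p > 2" and d: "d > 0" "coprime d ((p - 1) div 2)"
    and a: "[a ^ (2 * d) = 1] (mod int p)"
  shows "[a = 1] (mod int p) \<or> [a = -1] (mod int p)"
proof -
  have "coprime a (int p)"
    using a d(1) by (metis cong_imp_coprime cong_sym coprime_1_left coprime_power_left_iff
        mult_eq_0_iff neq0_conv zero_neq_numeral)
  \<comment> \<open>A natural representative of \<open>a\<close>, to which
    \<open>fermat_theorem\<close> applies.\<close>
  define b where "b = nat (a mod int p)"
  have ab: "[int b = a] (mod int p)" using p by (simp add: b_def cong_def)
  have "coprime (int b) (int p)"
    using \<open>coprime a (int p)\<close> ab by (meson cong_imp_coprime cong_sym)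
  then have "\<not> p dvd b"
    using p by (metis coprime_int_iff coprime_absorb_right not_prime_unit)
  then have "[b ^ (p - 1) = 1] (mod p)" using p by (intro fermat_theorem)
  then have "[int b ^ (p - 1) = 1] (mod int p)" by (simp flip: cong_int_iff)
  then have fermat: "[a ^ (p - 1) = 1] (mod int p)"
    using ab by (meson cong_pow cong_sym cong_trans)
  have "odd p" using p by (simp add: prime_odd_nat)
  then have p1: "p - 1 = 2 * ((p - 1) div 2)" by simp
  have "gcd (2 * d) (2 * ((p - 1) div 2)) = 2 * gcd d ((p - 1) div 2)"
    by (rule gcd_mult_distrib_nat[symmetric])
  then have "gcd (2 * d) (p - 1) = 2" using d(2) p1 by simp
  then obtain s t where st: "2 * d * s = (p - 1) * t + 2"
    using bezout_nat[of "2 * d" "p - 1"] d(1) by auto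
  have "[(a ^ (2 * d)) ^ s = 1 ^ s] (mod int p)" using a by (rule cong_pow)
  moreover have "(a ^ (2 * d)) ^ s = (a ^ (p - 1)) ^ t * a ^ 2"
    by (metis st power_add power_mult)
  moreover have "[(a ^ (p - 1)) ^ t * a ^ 2 = 1 ^ t * a ^ 2] (mod int p)"
    by (intro cong_mult cong_pow fermat cong_refl)
  ultimately have "[a ^ 2 = 1] (mod int p)" by (metis cong_sym cong_trans mult_1 power_one)
  then have "int p dvd (a - 1) * (a + 1)"
    by (simp add: cong_iff_dvd_diff power2_eq_square algebra_simps)
  then have "int p dvd a - 1 \<or> int p dvd a + 1" using p by (simp add: prime_dvd_mult_iff)
  then show ?thesis by (auto simp: cong_iff_dvd_diff)
qed

lemma (in ramification_filtration) unit_residue: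
  assumes nf: "number_field TYPE('a)" and n: "n = field_degree TYPE('a)"
    and cop: "coprime n ((p - 1) div 2)" and p2: "p > 2"
    and u: "u \<noteq> 0" "algebraic_int u" "algebraic_int (inverse u)"
  shows "u - 1 \<in> Q 1 \<or> u + 1 \<in> Q 1"
proof -
  have n0: "n > 0" using n field_degree_pos[OF nf] by simp
  obtain a where a: "u - of_int a \<in> Q 1" using residue_integer[OF nf n n0 u(2)] by blast
  then have "algebraic_int ((u - of_int a) ^ n / of_nat p)"
    using Q_power Q_n by blast
  from unit_power_cong[OF nf p n0 u(1,3) this]
  obtain d where d: "d dvd n" "[a ^ (2 * d) = 1] (mod int p)" using n by blast
  have "d > 0" using d(1) n0 by (rule dvd_pos_nat[rotated])
  moreover have "coprime d ((p - 1) div 2)" using coprime_divisors[OF d(1) dvd_refl cop] .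
  ultimately have disj: "[a = 1] (mod int p) \<or> [a = -1] (mod int p)"
    using d(2) p p2 by (intro cong_1_or_minus_1_if_power_cong_1)
  \<comment> \<open>Replacing \<open>a\<close> by a congruent integer changes the difference by a
    multiple of \<open>p\<close>, which lies in \<open>Q 1\<close>.\<close>
  have "u - of_int e \<in> Q 1" if "[a = e] (mod int p)" for e
  proof -
    have "int p dvd a - e" using that by (simp add: cong_iff_dvd_diff)
    then have "of_int (a - e) * 1 \<in> Q 1" using n0 by (intro dvd_mult_mem_Q) auto
    with a have "(u - of_int a) + of_int (a - e) * 1 \<in> Q 1" by (rule Q_add)
    then show ?thesis by simp
  qed
  from this[of 1] this[of "-1"] show ?thesis using disj by auto
qed

theorem corollary1:
  fixes p :: nat
  assumes "number_field TYPE('a::field_char_0)"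
    and "Factorial_Ring.prime p" and "p \<ge> 5"
    and "totally_ramified TYPE('a) p"
    and "gcd (field_degree TYPE('a)) ((p - 1) div 2) = 1"
    and "gcd (2 * class_number TYPE('a)) (p - 1) = 2"
  shows "\<not> (\<exists>u v. u \<in> Units (ring_of_integers TYPE('a)) \<and>
                 v \<in> Units (ring_of_integers TYPE('a)) \<and> u + v = 1)"
proof
  assume "\<exists>u v. u \<in> Units (ring_of_integers TYPE('a)) \<and>
                 v \<in> Units (ring_of_integers TYPE('a)) \<and> u + v = 1"
  then obtain u v :: 'a where uv: "u \<in> Units (ring_of_integers TYPE('a))"
    "v \<in> Units (ring_of_integers TYPE('a))" "u + v = 1" by blast
  obtain Q :: "nat \<Rightarrow> 'a set" where "ramification_filtration Q (field_degree TYPE('a)) p"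
    using totally_ramified_filtration[OF assms(4,2)] .
  then interpret ramification_filtration Q "field_degree TYPE('a)" p .
  have cop: "coprime (field_degree TYPE('a)) ((p - 1) div 2)"
    using assms(5) by (simp add: coprime_iff_gcd_eq_1)
  have res: "w - 1 \<in> Q 1 \<or> w + 1 \<in> Q 1" if w: "w \<in> Units (ring_of_integers TYPE('a))" for w
  proof -
    obtain z where z: "z * w = 1" "algebraic_int w" "algebraic_int z"
      using w unfolding Units_def by auto
    then have "w \<noteq> 0" "inverse w = z" by (auto simp: inverse_unique mult.commute)
    then show ?thesis using z assms(3) by (intro unit_residue[OF assms(1) refl cop]) auto
  qed
  have no: "of_int k \<notin> Q 1" if "k \<noteq> 0" "\<bar>k\<bar> < 5" for k :: int
  proof
    assume "of_int k \<in> Q 1"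
    then have "int p dvd k" using field_degree_pos[OF assms(1)] by (rule of_int_mem_Q_1)
    then have "int p \<le> \<bar>k\<bar>" using that(1) by (metis abs_of_nat dvd_imp_le_int)
    then show False using that(2) assms(3) by linarith
  qed
  \<comment> \<open>With \<open>u + v = 1\<close>, adding the two memberships puts -1, 1, 1 or 3
    into \<open>Q 1\<close>, and none of these is divisible by \<open>p \<ge> 5\<close>.\<close>
  consider "u - 1 \<in> Q 1" "v - 1 \<in> Q 1" | "u - 1 \<in> Q 1" "v + 1 \<in> Q 1"
    | "u + 1 \<in> Q 1" "v - 1 \<in> Q 1" | "u + 1 \<in> Q 1" "v + 1 \<in> Q 1"
    using res[OF uv(1)] res[OF uv(2)] by blast
  then show False
  proof cases
    case 1
    have "(u - 1) + (v - 1) = of_int (-1)" using uv(3) by (simp add: algebra_simps)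
    then show False using Q_add[OF 1] no[of "-1"] by simp
  next
    case 2
    have "(u - 1) + (v + 1) = of_int 1" using uv(3) by simp
    then show False using Q_add[OF 2] no[of 1] by simp
  next
    case 3
    have "(u + 1) + (v - 1) = of_int 1" using uv(3) by simp
    then show False using Q_add[OF 3] no[of 1] by simp
  next
    case 4
    have "(u + 1) + (v + 1) = (u + v) + 2" by simp
    then have "(u + 1) + (v + 1) = of_int 3" using uv(3) by simp
    then show False using Q_add[OF 4] no[of 3] by simp
  qed
qed

end
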